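(* Let $n \ge 2$ and $u \in \mathbb{F}_2^n$. Let $D_2(u)$ be the set of vectors in $\mathbb{F}_2^{n-2}$ obtainable from $u$ by deleting two of its components, let $r(u)$ be the number of runs of $u$, let $u' \in \mathbb{F}_2^{n-1}$ be the derivative of $u$ and $u'' \in \mathbb{F}_2^{n-2}$ the derivative of $u'$. Then $$|D_2(u)| = \binom{r(u)+1}{2} - \delta, \qquad \text{where } \delta = 2\,\mathrm{wt}(u') - \mathrm{wt}(u'').$$
   Context: A run of $u$ is a maximal block of consecutive equal symbols. The derivative of $u=(u_1,\ldots,u_n)$ is $u' = (u_1+u_2, u_2+u_3, \ldots, u_{n-1}+u_n)$ with addition mod 2 (for a vector of length 1 the derivative is the empty vector). $\mathrm{wt}$ denotes Hamming weight (number of nonzero coordinates). *)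

theory Defs
  imports Main "HOL-Library.Z2"
begin

text \<open>Vectors in $F_2^n$ are lists of length $n$ over the two-element field \<^typ>\<open>bit\<close>;
  the coordinates are indexed from 0.\<close>

definition deletions :: "nat \<Rightarrow> 'a list \<Rightarrow> 'a list set" where
  "deletions t u = {nths u (- I) | I. I \<subseteq> {..<length u} \<and> card I = t}"

definition const_block :: "'a list \<Rightarrow> nat set \<Rightarrow> bool" where
  "const_block u B \<longleftrightarrow>
     (\<exists>i j. i \<le> j \<and> j < length u \<and> B = {i..j}) \<and> (\<forall>k\<in>B. \<forall>l\<in>B. u ! k = u ! l)"

text \<open>A run is represented by the set of its positions.\<close>

definition is_run :: "'a list \<Rightarrow> nat set \<Rightarrow> bool" where
  "is_run u B \<longleftrightarrow> const_block u B \<and> (\<forall>C. const_block u C \<and> B \<subseteq> C \<longrightarrow> C = B)"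

definition num_runs :: "'a list \<Rightarrow> nat" where
  "num_runs u = card {B. is_run u B}"

definition derivative :: "bit list \<Rightarrow> bit list" where
  "derivative u = map (\<lambda>i. u ! i + u ! (i + 1)) [0..<length u - 1]"

definition wt :: "bit list \<Rightarrow> nat" where
  "wt u = card {i. i < length u \<and> u ! i \<noteq> 0}"

end

theory Submission
  imports Defs "HOL-Library.Sublist"
begin

text \<open>
  Classify the words of \<open>D\<^sub>2(u)\<close>, \<open>u = a b c \<dots>\<close>, by their first letter. Those starting
  with \<open>a\<close> are in bijection with \<open>D\<^sub>2(b c \<dots>)\<close>. Those starting with the other letter arise by
  deleting an initial block of \<open>a\<close>s: they are counted by \<open>D\<^sub>1(c \<dots>)\<close> if \<open>b \<noteq> a\<close>, there is
  exactly one if \<open>b = a \<noteq> c\<close>, and none otherwise. As \<open>|D\<^sub>1(v)| = r(v) = 1 + wt(v')\<close>, both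
  sides of the claim satisfy the same recursion.
\<close>

section \<open>Deletion sets as sets of subsequences\<close>

text \<open>Deleting the positions in \<open>I\<close> keeps those in the complement. In this form
  the recursive rules for \<open>subseq\<close> apply, and the additive length condition makes both
  sides empty when \<open>t\<close> exceeds \<open>length u\<close>.\<close>

lemma deletions_eq_subseq:
  "deletions t u = {y. subseq y u \<and> length y + t = length u}"
proof (intro equalityI subsetI)
  fix y assume "y \<in> deletions t u"
  then obtain I where I: "I \<subseteq> {..<length u}" "card I = t" "y = nths u (- I)"
    by (auto simp: deletions_def)
  have "{i. i < length u \<and> i \<in> - I} = {..<length u} - I" by auto
  then have "length y = length u - t"
    using I by (simp add: length_nths card_Diff_subset finite_subset)
  moreover have "t \<le> length u"
    using I card_mono[of "{..<length u}" I] by simp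
  ultimately show "y \<in> {y. subseq y u \<and> length y + t = length u}"
    using I by (auto simp: subseq_conv_nths)
next
  fix y assume "y \<in> {y. subseq y u \<and> length y + t = length u}"
  then obtain N where N: "y = nths u N" and len: "length y + t = length u"
    by (auto simp: subseq_conv_nths)
  let ?I = "{..<length u} - N"
  \<comment> \<open>\<open>N\<close> may miss positions beyond the end of \<open>u\<close>, so
    \<open>- ?I\<close> need not equal \<open>N\<close>; the two agree on the positions of
    \<open>u\<close>.\<close>
  have "y = nths u (- ?I)"
    unfolding N nths_def by (rule arg_cong[where f = "map fst"], rule filter_cong)
      (auto dest!: set_zip_rightD)
  moreover have "card ?I = t"
  proof -
    have "{..<length u} - ?I = {i. i < length u \<and> i \<in> N}" by auto
    then have "length y = card ({..<length u} - ?I)" by (simp add: N length_nths)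
    also have "\<dots> = length u - card ?I" by (subst card_Diff_subset) auto
    finally show ?thesis
      using len card_mono[of "{..<length u}" ?I] by simp
  qed
  ultimately show "y \<in> deletions t u"
    unfolding deletions_def by blast
qed

lemma finite_deletions: "finite (deletions t u)"
proof (rule finite_subset)
  show "deletions t u \<subseteq> (\<lambda>I. nths u (- I)) ` Pow {..<length u}"
    by (auto simp: deletions_def)
qed simp

lemma deletions_length: "deletions (length u) u = {[]}"
  by (auto simp: deletions_eq_subseq)

section \<open>Splitting deletion sets by the first letter\<close>

lemma subseq_Cons_neq:
  assumes "subseq (x # z) (a # w)" "x \<noteq> a"
  shows "subseq (x # z) w"
  using assms by (simp add: subseq_Cons2_neq)

lemma deletions_1_Cons_Cons:
  "deletions 1 (a # b # w) =
    Cons a ` deletions 1 (b # w) \<union> (if a \<noteq> b then {b # w} else {})"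
proof (intro equalityI subsetI)
  fix y assume "y \<in> deletions 1 (a # b # w)"
  then obtain x z where y: "y = x # z" "subseq (x # z) (a # b # w)" "length z = length w"
    by (cases y) (auto simp: deletions_eq_subseq)
  show "y \<in> Cons a ` deletions 1 (b # w) \<union> (if a \<noteq> b then {b # w} else {})"
  proof (cases "x = a")
    case True
    with y show ?thesis by (auto simp: deletions_eq_subseq)
  next
    case False
    with y subseq_Cons_neq have "subseq (x # z) (b # w)" by metis
    \<comment> \<open>The single deletion is spent on \<open>a\<close>: both words now have the same
      length.\<close>
    with y have "x # z = b # w" by (intro subseq_same_length) auto
    with y False show ?thesis by auto
  qed
next
  fix y assume "y \<in> Cons a ` deletions 1 (b # w) \<union> (if a \<noteq> b then {b # w} else {})"
  then show "y \<in> deletions 1 (a # b # w)"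
    by (auto simp: deletions_eq_subseq split: if_splits)
qed

text \<open>A word not starting with \<open>a\<close> has lost \<open>a\<close>. If
  \<open>b = a\<close>, it has lost \<open>b\<close> as well, so only \<open>c # w\<close> remains
  possible. If \<open>b \<noteq> a\<close>, the binary alphabet forces the word to start with
  \<open>b\<close>, and one deletion is left for \<open>c # w\<close>.\<close>

lemma deletions_2_Cons_Cons_Cons:
  fixes a b c :: bit
  shows "deletions 2 (a # b # c # w) =
    Cons a ` deletions 2 (b # c # w) \<union>
      (if b \<noteq> a then Cons b ` deletions 1 (c # w) else if c \<noteq> a then {c # w} else {})"
    (is "_ = ?R")
proof (intro equalityI subsetI)
  fix y assume "y \<in> deletions 2 (a # b # c # w)"
  then obtain x z where y: "y = x # z" "subseq (x # z) (a # b # c # w)" "length z = length w"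
    by (cases y) (auto simp: deletions_eq_subseq)
  show "y \<in> ?R"
  proof (cases "x = a")
    case True
    with y show ?thesis by (auto simp: deletions_eq_subseq)
  next
    case xa: False
    with y subseq_Cons_neq have s: "subseq (x # z) (b # c # w)" by metis
    show ?thesis
    proof (cases "b = a")
      case True
      with s xa subseq_Cons_neq have "subseq (x # z) (c # w)" by metis
      with y have "x # z = c # w" by (intro subseq_same_length) auto
      with y xa True show ?thesis by auto
    next
      case False
      with xa have "x = b" by (cases x; cases a; cases b) auto
      with s y False show ?thesis by (auto simp: deletions_eq_subseq)
    qed
  qed
next
  fix y assume "y \<in> ?R"
  then show "y \<in> deletions 2 (a # b # c # w)"
    by (auto simp: deletions_eq_subseq split: if_splits)
qed

section \<open>Weights of derivatives and the cardinality recursions\<close>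

lemma derivative_singleton: "derivative [a] = []"
  by (simp add: derivative_def)

lemma derivative_Cons_Cons:
  "derivative (a # b # w) = (a + b) # derivative (b # w)"
  by (simp add: derivative_def map_upt_Suc del: upt_Suc)

lemma wt_Nil: "wt [] = 0"
  by (simp add: wt_def)

lemma wt_Cons: "wt (x # xs) = (if x \<noteq> 0 then 1 else 0) + wt xs"
proof -
  have "{i. i < length (x # xs) \<and> (x # xs) ! i \<noteq> 0} =
      (if x \<noteq> 0 then {0} else {}) \<union> Suc ` {i. i < length xs \<and> xs ! i \<noteq> 0}"
    (is "?L = ?R")
  proof (rule set_eqI)
    fix i show "i \<in> ?L \<longleftrightarrow> i \<in> ?R" by (cases i) auto
  qed
  then show ?thesis
    unfolding wt_def by (simp add: card_image)
qed

lemma bit_add_eq_0_iff: "a + b = 0 \<longleftrightarrow> a = b" for a b :: bit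
  by (cases a; cases b) auto

text \<open>The two pieces of the recursion differ in their first letter, so their sizes add up. The
  second piece adds one word exactly when the new derivative entry \<open>a + b\<close> is
  nonzero.\<close>

lemma card_deletions_1:
  "u \<noteq> [] \<Longrightarrow> card (deletions 1 u) = wt (derivative u) + 1"
proof (induction u rule: induct_list012)
  case (2 a)
  then show ?case
    using deletions_length[of "[a]"] by (simp add: derivative_singleton wt_Nil)
next
  case (3 a b w)
  have "card (deletions 1 (a # b # w)) =
      card (Cons a ` deletions 1 (b # w)) + card (if a \<noteq> b then {b # w} else {})"
    unfolding deletions_1_Cons_Cons
    by (rule card_Un_disjoint) (auto simp: finite_deletions)
  also have "card (Cons a ` deletions 1 (b # w)) = card (deletions 1 (b # w))"
    by (simp add: card_image)
  finally show ?case
    using 3 by (cases a; cases b) (simp_all add: derivative_Cons_Cons wt_Cons)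
qed simp

lemma card_deletions_2_Cons_Cons_Cons:
  fixes a b c :: bit
  shows "card (deletions 2 (a # b # c # w)) = card (deletions 2 (b # c # w)) +
      (if b \<noteq> a then wt (derivative (c # w)) + 1 else if c \<noteq> a then 1 else 0)"
proof -
  let ?S = "if b \<noteq> a then Cons b ` deletions 1 (c # w) else if c \<noteq> a then {c # w} else {}"
  have "card (deletions 2 (a # b # c # w)) =
      card (Cons a ` deletions 2 (b # c # w)) + card ?S"
    unfolding deletions_2_Cons_Cons_Cons
    by (rule card_Un_disjoint) (auto simp: finite_deletions)
  moreover have "card (Cons a ` deletions 2 (b # c # w)) = card (deletions 2 (b # c # w))"
    by (simp add: card_image)
  moreover have "card (Cons b ` deletions 1 (c # w)) = wt (derivative (c # w)) + 1"
    by (subst card_image) (simp_all add: card_deletions_1[simplified])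
  ultimately show ?thesis by simp
qed

section \<open>Runs and their first positions\<close>

lemma const_block_atLeastAtMost:
  assumes "i \<le> j"
  shows "const_block u {i..j} \<longleftrightarrow> j < length u \<and> (\<forall>k\<in>{i..j}. u ! k = u ! i)"
proof
  assume B: "const_block u {i..j}"
  then obtain i' j' where "i' \<le> j'" "j' < length u" "{i..j} = {i'..j'}"
    by (auto simp: const_block_def)
  with assms have "j < length u" by (simp add: Icc_eq_Icc)
  moreover have "i \<in> {i..j}" using assms by simp
  ultimately show "j < length u \<and> (\<forall>k\<in>{i..j}. u ! k = u ! i)"
    using B unfolding const_block_def by blast
next
  assume "j < length u \<and> (\<forall>k\<in>{i..j}. u ! k = u ! i)"
  with assms show "const_block u {i..j}"
    unfolding const_block_def by metis
qed

lemma is_runE: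
  assumes "is_run u B"
  obtains i j where "i \<le> j" "j < length u" "B = {i..j}"
    "\<forall>k\<in>{i..j}. u ! k = u ! i" "i = 0 \<or> u ! (i - 1) \<noteq> u ! i"
proof -
  from assms have B: "const_block u B"
    and max: "\<And>C. const_block u C \<Longrightarrow> B \<subseteq> C \<Longrightarrow> C = B"
    by (auto simp: is_run_def)
  from B obtain i j where ij: "i \<le> j" "j < length u" "B = {i..j}"
    by (auto simp: const_block_def)
  with B have const: "\<forall>k\<in>{i..j}. u ! k = u ! i"
    using const_block_atLeastAtMost by blast
  \<comment> \<open>Otherwise the block could be extended by one position to the left, against
    maximality.\<close>
  have "i = 0 \<or> u ! (i - 1) \<noteq> u ! i"
  proof (rule ccontr)
    assume "\<not> ?thesis"
    then have i: "i > 0" "u ! (i - 1) = u ! i" by auto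
    have "u ! k = u ! (i - 1)" if "k \<in> {i - 1..j}" for k
    proof (cases "k = i - 1")
      case False
      with that have "k \<in> {i..j}" by auto
      with const i show ?thesis by metis
    qed simp
    moreover have "i - 1 \<le> j" using ij by simp
    ultimately have "const_block u {i - 1..j}"
      using ij const_block_atLeastAtMost by blast
    from max[OF this] ij have "{i - 1..j} = {i..j}" by auto
    with i ij show False by (auto simp: Icc_eq_Icc)
  qed
  with that ij const show ?thesis by blast
qed

text \<open>The longest constant block starting at \<open>i\<close> is a run: a constant block
  containing it cannot start earlier, since it would contain both \<open>i - 1\<close> and
  \<open>i\<close>, where the entries differ.\<close>

lemma ex_is_run_from:
  assumes i: "i < length u" and start: "i = 0 \<or> u ! (i - 1) \<noteq> u ! i"
  shows "\<exists>j\<ge>i. is_run u {i..j}"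
proof -
  define J where "J = {j. i \<le> j \<and> const_block u {i..j}}"
  have "J \<subseteq> {..<length u}" by (auto simp: J_def const_block_atLeastAtMost)
  then have fin: "finite J" by (rule finite_subset) simp
  have "i \<in> J" using i const_block_atLeastAtMost[of i i u] by (simp add: J_def)
  with fin have "Max J \<in> J" by (intro Max_in) auto
  then have j: "i \<le> Max J" "const_block u {i..Max J}" by (auto simp: J_def)
  have "C = {i..Max J}" if C: "const_block u C" "{i..Max J} \<subseteq> C" for C
  proof -
    from C obtain i' j' where C': "i' \<le> j'" "C = {i'..j'}"
      by (auto simp: const_block_def)
    with C j have le: "i' \<le> i" "Max J \<le> j'" by auto
    have "i' = i"
    proof (rule ccontr)
      assume "i' \<noteq> i"
      with le j C' have "i - 1 \<in> C" "i \<in> C" "i > 0" by auto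
      with C start show False unfolding const_block_def by blast
    qed
    with C C' le j have "j' \<in> J" by (simp add: J_def)
    with fin have "j' \<le> Max J" by simp
    with le C' \<open>i' = i\<close> show ?thesis by simp
  qed
  with j show ?thesis by (auto simp: is_run_def)
qed

text \<open>A run is determined by its first position, so runs are counted by the positions
  that differ from their predecessor.\<close>

lemma num_runs_eq_wt_derivative:
  assumes "u \<noteq> []"
  shows "num_runs u = wt (derivative u) + 1"
proof -
  let ?S = "{i. i < length u \<and> (i = 0 \<or> u ! (i - 1) \<noteq> u ! i)}"
  have "bij_betw Min {B. is_run u B} ?S"
  proof (rule bij_betw_imageI)
    show "inj_on Min {B. is_run u B}"
    proof (rule inj_onI, unfold mem_Collect_eq)
      fix B C assume B: "is_run u B" and C: "is_run u C" and eq: "Min B = Min C"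
      obtain i j where ij: "i \<le> j" "B = {i..j}" using B by (elim is_runE)
      obtain i' j' where ij': "i' \<le> j'" "C = {i'..j'}" using C by (elim is_runE)
      have "Min B = i" using ij by (auto intro: Min_eqI)
      moreover have "Min C = i'" using ij' by (auto intro: Min_eqI)
      \<comment> \<open>Intervals with the same left end are nested, so maximality makes them
        equal.\<close>
      ultimately have "B \<subseteq> C \<or> C \<subseteq> B" using eq ij ij' by auto
      with B C show "B = C" unfolding is_run_def by blast
    qed
    show "Min ` {B. is_run u B} = ?S"
    proof (intro equalityI subsetI)
      fix m assume "m \<in> Min ` {B. is_run u B}"
      then obtain B where B: "is_run u B" "m = Min B" by auto
      from B(1) obtain i j where ij: "i \<le> j" "j < length u" "B = {i..j}"
        and i: "i = 0 \<or> u ! (i - 1) \<noteq> u ! i" by (elim is_runE)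
      have "Min B = i" using ij by (auto intro: Min_eqI)
      with B ij i show "m \<in> ?S" by auto
    next
      fix i assume "i \<in> ?S"
      then obtain j where j: "i \<le> j" "is_run u {i..j}" using ex_is_run_from by blast
      have "Min {i..j} = i" using j by (auto intro: Min_eqI)
      with j show "i \<in> Min ` {B. is_run u B}" by (metis imageI mem_Collect_eq)
    qed
  qed
  then have "num_runs u = card ?S"
    unfolding num_runs_def by (rule bij_betw_same_card)
  \<comment> \<open>Position 0 always starts a run and gives the summand 1; the other starts are
    shifted by one to match the indices of the derivative.\<close>
  also have "?S = insert 0 (Suc ` {i. i < length u - 1 \<and> u ! i \<noteq> u ! Suc i})"
    (is "_ = insert 0 (Suc ` ?T)")
  proof (rule set_eqI)
    fix i show "i \<in> ?S \<longleftrightarrow> i \<in> insert 0 (Suc ` ?T)"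
      using assms by (cases i) auto
  qed
  also have "card \<dots> = card ?T + 1"
    by (simp add: card_image)
  also have "?T = {i. i < length (derivative u) \<and> derivative u ! i \<noteq> 0}"
    by (auto simp: derivative_def bit_add_eq_0_iff)
  finally show ?thesis by (simp add: wt_def)
qed

section \<open>The count for two deletions\<close>

lemma card_deletions_2:
  "2 \<le> length u \<Longrightarrow> int (card (deletions 2 u)) =
    int ((wt (derivative u) + 2) choose 2)
      - (2 * int (wt (derivative u)) - int (wt (derivative (derivative u))))"
proof (induction u)
  case (Cons a v)
  show ?case
  proof (cases "length v = 1")
    case True
    then obtain b where v: "v = [b]" by (auto simp: length_Suc_conv)
    \<comment> \<open>With \<open>k = wt (derivative u)\<close>, here 0 or 1, and an empty second
      derivative, the right-hand side is \<open>((k + 2) choose 2) - 2 * k = 1\<close> in both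
      cases.\<close>
    have "deletions 2 [a, b] = {[]}" using deletions_length[of "[a, b]"]
      by (simp add: numeral_2_eq_2)
    then show ?thesis
      by (simp add: v derivative_Cons_Cons derivative_singleton wt_Nil wt_Cons
          derivative_def[of "[]"] numeral_2_eq_2)
  next
    case False
    with Cons.prems obtain b c w where v: "v = b # c # w"
      by (cases v; cases "tl v") auto
    have "int (card (deletions 2 (b # c # w))) =
        int ((wt (derivative (b # c # w)) + 2) choose 2)
        - (2 * int (wt (derivative (b # c # w))) - int (wt (derivative (derivative (b # c # w)))))"
      using Cons.IH by (simp add: v)
    \<comment> \<open>Let \<open>k\<close> be the weight of the derivative of
      \<open>b # c # w\<close>. If \<open>a \<noteq> b\<close>, the binomial grows by
      \<open>k + 2\<close>, twice the first weight by 2, and the second weight by 1 exactly when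
      \<open>b = c\<close>; the net gain is the size of the \<open>D_1\<close> term. If
      \<open>a = b\<close>, only the second weight can grow, by 1 exactly when
      \<open>c \<noteq> a\<close>.\<close>
    then show ?thesis
      unfolding v card_deletions_2_Cons_Cons_Cons
      by (cases a; cases b; cases c)
        (simp_all add: derivative_Cons_Cons wt_Cons numeral_2_eq_2)
  qed
qed simp

theorem theorem6:
  fixes n :: nat and u :: "bit list"
  assumes "n \<ge> 2" and "length u = n"
  shows "int (card (deletions 2 u)) =
    int ((num_runs u + 1) choose 2)
      - (2 * int (wt (derivative u)) - int (wt (derivative (derivative u))))"
proof -
  have "u \<noteq> []" using assms by auto
  then show ?thesis
    using card_deletions_2[of u] assms by (simp add: num_runs_eq_wt_derivative)
qed

end
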